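(* The natural tensor product structure (TPS) in $R_1$-perspective, $[\mathcal R_1^{g_1}]$, i.e. the equivalence class of the isomorphisms $\mathcal R_1^{g_1}:\mathcal H_{\rm phys}\to\mathcal H_2\otimes\mathcal H_S$, and the natural TPS in $R_2$-perspective, $[\mathcal R_2^{g_2}]$, i.e. the equivalence class of the isomorphisms $\mathcal R_2^{g_2}:\mathcal H_{\rm phys}\to\mathcal H_1\otimes\mathcal H_S$, are inequivalent.
   Context: $\mathcal G$ is a finite abelian group, $\mathcal G\neq\{e\}$. For $i=1,2$ (two ideal quantum reference frames $R_1,R_2$), $\mathcal H_i=\ell^2(\mathcal G)\cong\mathbb C^{|\mathcal G|}$ has orthonormal basis $\{|g\rangle_i\}_{g\in\mathcal G}$ and carries the regular representation $U_i^g|g'\rangle_i=|gg'\rangle_i$. $\mathcal H_S$ is a (possibly infinite-dimensional) complex Hilbert space carrying a unitary representation $g\mapsto U_S^g$ of $\mathcal G$. On $\mathcal H_{\rm kin}=\mathcal H_1\otimes\mathcal H_2\otimes\mathcal H_S$ let $U_{12S}^g=U_1^g\otimes U_2^g\otimes U_S^g$, $\Pi_{\rm phys}=\frac1{|\mathcal G|}\sum_{g\in\mathcal G}U_{12S}^g$ and $\mathcal H_{\rm phys}=\Pi_{\rm phys}(\mathcal H_{\rm kin})$. For $i\ne j$ and $g\in\mathcal G$ the reduction map $\mathcal R_i^g=\sqrt{|\mathcal G|}\,(\langle g|_i\otimes\mathbf 1_j\otimes\mathbf 1_S)\Pi_{\rm phys}:\mathcal H_{\rm phys}\to\mathcal H_j\otimes\mathcal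 H_S$ is unitary. A TPS on a Hilbert space $\mathcal H$ is an equivalence class of unitaries $\mathbf T:\mathcal H\to\bigotimes_{\alpha=1}^n\mathcal H_\alpha$, where $\mathbf T_1\sim\mathbf T_2$ if $\mathbf T_2\circ\mathbf T_1^{-1}$ is a product of multilocal unitaries $\otimes_\alpha U_\alpha$ and permutations of tensor factors of equal dimension. Here the abstract factors $\alpha=1,2$ are identified with $\mathcal H_2,\mathcal H_S$ in $R_1$-perspective and with $\mathcal H_1,\mathcal H_S$ in $R_2$-perspective (so $\mathcal H_1$ and $\mathcal H_2$, both equal to $\ell^2(\mathcal G)$, are identified as the first abstract factor). For fixed $i$, all $\mathcal R_i^g$, $g\in\mathcal G$, lie in the same equivalence class. One has $\mathcal R_2^{g_2}\circ(\mathcal R_1^{g_1})^{-1}=\sum_{g\in\mathcal G}|gg_1\rangle_1\otimes\langle g_2g^{-1}|_2\otimes U_S^g$.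
   Formalization: It is additionally assumed that some U_S^g is not a scalar multiple of the identity; if all U_S^g are scalar (e.g. U_S trivial or dim H_S ≤ 1), the change of perspective is a local unitary and the two TPSs coincide, so the claim fails. *)

theory Defs
  imports "HOL-Analysis.Analysis"
begin

text \<open>
  Complex Hilbert spaces. The inner product is conjugate-linear in the first argument, so that
  \<open>cinner a b\<close> is the Dirac bracket of a and b. Separability is not assumed.
\<close>

class chilbert_space = banach +
  fixes scaleC :: "complex \<Rightarrow> 'a \<Rightarrow> 'a" (infixr "*\<^sub>C" 75)
    and cinner :: "'a \<Rightarrow> 'a \<Rightarrow> complex"
  assumes scaleC_add_right: "c *\<^sub>C (x + y) = c *\<^sub>C x + c *\<^sub>C y"
    and scaleC_add_left: "(c + d) *\<^sub>C x = c *\<^sub>C x + d *\<^sub>C x"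
    and scaleC_scaleC: "c *\<^sub>C (d *\<^sub>C x) = (c * d) *\<^sub>C x"
    and scaleC_of_real: "complex_of_real r *\<^sub>C x = r *\<^sub>R x"
    and cinner_commute: "cinner x y = cnj (cinner y x)"
    and cinner_add_right: "cinner x (y + z) = cinner x y + cinner x z"
    and cinner_scaleC_right: "cinner x (c *\<^sub>C y) = c * cinner x y"
    and norm_eq_sqrt_cinner: "norm x = sqrt (Re (cinner x x))"

instantiation complex :: chilbert_space
begin

definition scaleC_complex :: "complex \<Rightarrow> complex \<Rightarrow> complex"
  where "scaleC_complex c x = c * x"

definition cinner_complex :: "complex \<Rightarrow> complex \<Rightarrow> complex"
  where "cinner_complex x y = cnj x * y"

instance
proof
  fix x :: complex
  show "norm x = sqrt (Re (cinner x x))"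
    by (simp add: cinner_complex_def norm_complex_def power2_eq_square)
qed (auto simp: scaleC_complex_def cinner_complex_def algebra_simps scaleR_conv_of_real)

end

lemma scaleC_one [simp]: "1 *\<^sub>C x = x" for x :: "'a::chilbert_space"
  using scaleC_of_real[of 1 x] by simp

lemma scaleC_zero_left [simp]: "0 *\<^sub>C x = 0" for x :: "'a::chilbert_space"
  using scaleC_of_real[of 0 x] by simp

lemma scaleC_zero_right [simp]: "c *\<^sub>C (0 :: 'a::chilbert_space) = 0"
  using scaleC_add_right[of c 0 "0 :: 'a"] by simp

lemma cinner_zero_right [simp]: "cinner x 0 = 0" for x :: "'a::chilbert_space"
  using cinner_add_right[of x 0 0] by simp

lemma cinner_zero_left [simp]: "cinner 0 x = 0" for x :: "'a::chilbert_space"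
  using cinner_commute[of 0 x] by simp

lemma cinner_add_left: "cinner (x + y) z = cinner x z + cinner y z" for x :: "'a::chilbert_space"
  using cinner_commute cinner_add_right by (metis complex_cnj_add)

lemma cinner_scaleC_left: "cinner (c *\<^sub>C x) y = cnj c * cinner x y" for x :: "'a::chilbert_space"
  using cinner_commute cinner_scaleC_right by (metis complex_cnj_mult)

lemma cinner_self_Re: "Re (cinner x x) = (norm x)\<^sup>2" for x :: "'a::chilbert_space"
proof -
  have "sqrt (Re (cinner x x)) \<ge> 0"
    by (metis norm_eq_sqrt_cinner norm_ge_zero)
  then have "Re (cinner x x) \<ge> 0"
    by simp
  then show ?thesis
    by (simp add: norm_eq_sqrt_cinner)
qed

lemma scaleC_sum_right: "c *\<^sub>C (\<Sum>i\<in>A. f i) = (\<Sum>i\<in>A. c *\<^sub>C f i)"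
  for c :: complex and f :: "'b \<Rightarrow> 'a::chilbert_space"
  by (induction A rule: infinite_finite_induct) (auto simp: scaleC_add_right)

lemma scaleC_sum_left: "(\<Sum>i\<in>A. c i) *\<^sub>C x = (\<Sum>i\<in>A. c i *\<^sub>C x)"
  for x :: "'a::chilbert_space"
  by (induction A rule: infinite_finite_induct) (auto simp: scaleC_add_left)

text \<open>
  The type \<^typ>\<open>complex ^ 'n\<close> is the space of square-summable functions on the finite index type
  'n, and \<^typ>\<open>'s ^ 'n\<close> is its Hilbert tensor product with the Hilbert space 's; the lemmas
  \<open>cinner_tensor\<close> and \<open>tensor_decomposition\<close> below characterise it as such.
\<close>

instantiation vec :: (chilbert_space, finite) chilbert_space
begin

definition scaleC_vec :: "complex \<Rightarrow> 'a ^ 'b \<Rightarrow> 'a ^ 'b"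
  where "scaleC_vec c x = (\<chi> i. c *\<^sub>C x $ i)"

definition cinner_vec :: "'a ^ 'b \<Rightarrow> 'a ^ 'b \<Rightarrow> complex"
  where "cinner_vec x y = (\<Sum>i\<in>UNIV. cinner (x $ i) (y $ i))"

instance
proof
  fix x y :: "'a ^ 'b"
  show "cinner x y = cnj (cinner y x)"
    unfolding cinner_vec_def cnj_sum by (rule sum.cong[OF refl]) (rule cinner_commute)
  show "norm x = sqrt (Re (cinner x x))"
    by (simp add: norm_vec_def L2_set_def cinner_vec_def cinner_self_Re)
qed (auto simp: scaleC_vec_def cinner_vec_def vec_eq_iff scaleC_add_right scaleC_add_left
        scaleC_scaleC scaleC_of_real cinner_add_right cinner_scaleC_right
        sum.distrib sum_distrib_left)

end

lemma scaleC_vec_nth [simp]: "(c *\<^sub>C x) $ i = c *\<^sub>C x $ i"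
  by (simp add: scaleC_vec_def)

definition ket :: "'n::finite \<Rightarrow> complex ^ 'n"
  where "ket i = axis i 1"

definition tensor :: "complex ^ 'n::finite \<Rightarrow> 's::chilbert_space \<Rightarrow> 's ^ 'n"
    (infixr "\<otimes>\<^sub>v" 72)
  where "a \<otimes>\<^sub>v x = (\<chi> i. (a $ i) *\<^sub>C x)"

lemma cinner_tensor: "cinner (a \<otimes>\<^sub>v x) (b \<otimes>\<^sub>v y) = cinner a b * cinner x y"
  by (simp add: tensor_def cinner_vec_def cinner_complex_def cinner_scaleC_left
      cinner_scaleC_right sum_distrib_left sum_distrib_right algebra_simps)

lemma ket_nth: "ket i $ j = (if i = j then 1 else 0)"
  by (auto simp: ket_def axis_def)

lemma cinner_ket: "cinner (ket i) (ket j) = (if i = j then 1 else 0)"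
proof -
  have "cinner (ket i) (ket j) = (\<Sum>k\<in>UNIV. if k = i then (if i = j then 1 else 0) else 0)"
    unfolding cinner_vec_def by (rule sum.cong) (auto simp: ket_nth cinner_complex_def)
  then show ?thesis by simp
qed

lemma tensor_decomposition: "v = (\<Sum>i\<in>UNIV. ket i \<otimes>\<^sub>v (v $ i))"
proof -
  have "(\<Sum>i\<in>UNIV. ket i \<otimes>\<^sub>v (v $ i)) $ j = v $ j" for j
  proof -
    have "(\<Sum>i\<in>UNIV. ket i \<otimes>\<^sub>v (v $ i)) $ j = (\<Sum>i\<in>UNIV. if i = j then v $ i else 0)"
      unfolding sum_component by (rule sum.cong) (auto simp: tensor_def ket_nth)
    then show ?thesis by simp
  qed
  then show ?thesis by (simp add: vec_eq_iff)
qed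

text \<open>
  Tensor product of linear operators, and the partial bra of a vector a, i.e. the linear map
  sending \<open>b \<otimes>\<^sub>v x\<close> to \<open>cinner a b *\<^sub>C x\<close>.
\<close>

definition tensor_op ::
    "(complex ^ 'n::finite \<Rightarrow> complex ^ 'm::finite) \<Rightarrow> ('s::chilbert_space \<Rightarrow> 't::chilbert_space)
      \<Rightarrow> 's ^ 'n \<Rightarrow> 't ^ 'm"
    (infixr "\<otimes>\<^sub>o" 72)
  where "(A \<otimes>\<^sub>o B) v = (\<Sum>i\<in>UNIV. A (ket i) \<otimes>\<^sub>v B (v $ i))"

definition partial_bra :: "complex ^ 'n::finite \<Rightarrow> 's::chilbert_space ^ 'n \<Rightarrow> 's"
  where "partial_bra a v = (\<Sum>i\<in>UNIV. cinner a (ket i) *\<^sub>C (v $ i))"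

definition clinear_on ::
    "'a::chilbert_space set \<Rightarrow> ('a \<Rightarrow> 'b::chilbert_space) \<Rightarrow> bool"
  where "clinear_on H T \<longleftrightarrow>
    (\<forall>x\<in>H. \<forall>y\<in>H. T (x + y) = T x + T y) \<and> (\<forall>c. \<forall>x\<in>H. T (c *\<^sub>C x) = c *\<^sub>C T x)"

lemma tensor_op_tensor:
  assumes "clinear_on UNIV A" "clinear_on UNIV B"
  shows "(A \<otimes>\<^sub>o B) (a \<otimes>\<^sub>v x) = A a \<otimes>\<^sub>v B x"
proof -
  have A: "A (u + w) = A u + A w" "A (c *\<^sub>C u) = c *\<^sub>C A u" for u w c
    using assms(1) by (auto simp: clinear_on_def)
  have B: "B (c *\<^sub>C u) = c *\<^sub>C B u" for u c
    using assms(2) by (auto simp: clinear_on_def)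
  have A0: "A 0 = 0" using A(2)[of 0 0] by simp
  have Asum: "A (\<Sum>i\<in>I. f i) = (\<Sum>i\<in>I. A (f i))" for I :: "'a set" and f
    by (induction I rule: infinite_finite_induct) (auto simp: A A0)
  have "a = (\<Sum>i\<in>UNIV. (a $ i) *\<^sub>C ket i)"
  proof -
    have "ket i \<otimes>\<^sub>v c = c *\<^sub>C ket i" for i :: 'a and c
      by (simp add: vec_eq_iff tensor_def scaleC_complex_def)
    then show ?thesis using tensor_decomposition[of a] by simp
  qed
  then have "A a = (\<Sum>i\<in>UNIV. (a $ i) *\<^sub>C A (ket i))"
    by (metis (no_types, lifting) A(2) Asum sum.cong)
  then show ?thesis
    by (simp add: tensor_op_def vec_eq_iff tensor_def B scaleC_sum_left scaleC_scaleC
        scaleC_complex_def mult.commute)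
qed

lemma partial_bra_tensor: "partial_bra a (b \<otimes>\<^sub>v x) = cinner a b *\<^sub>C x"
proof -
  have "cinner a (ket i) = cnj (a $ i)" for i
  proof -
    have "cinner a (ket i) = (\<Sum>j\<in>UNIV. if j = i then cnj (a $ i) else 0)"
      unfolding cinner_vec_def by (rule sum.cong) (auto simp: ket_nth cinner_complex_def)
    then show ?thesis by simp
  qed
  then show ?thesis
    by (simp add: partial_bra_def tensor_def cinner_vec_def cinner_complex_def scaleC_sum_left
        scaleC_scaleC)
qed

definition unitary_on ::
    "'a::chilbert_space set \<Rightarrow> ('a \<Rightarrow> 'b::chilbert_space) \<Rightarrow> bool"
  where "unitary_on H T \<longleftrightarrow> clinear_on H T \<and>
    (\<forall>x\<in>H. \<forall>y\<in>H. cinner (T x) (T y) = cinner x y) \<and> T ` H = UNIV"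

abbreviation unitary :: "('a::chilbert_space \<Rightarrow> 'b::chilbert_space) \<Rightarrow> bool"
  where "unitary \<equiv> unitary_on UNIV"

text \<open>
  Tensor product structures with two factors. Two factors have equal dimension iff there is a
  unitary W between them; identifying them through W, their exchange is the linear map sending
  \<open>a \<otimes>\<^sub>v x\<close> to \<open>inv W x \<otimes>\<^sub>v W a\<close>.
\<close>

definition swap_factors ::
    "(complex ^ 'n::finite \<Rightarrow> 's::chilbert_space) \<Rightarrow> 's ^ 'n \<Rightarrow> 's ^ 'n"
  where "swap_factors W v = (\<Sum>i\<in>UNIV. inv W (v $ i) \<otimes>\<^sub>v W (ket i))"

inductive multilocal_perm :: "('s::chilbert_space ^ 'n::finite \<Rightarrow> 's ^ 'n) \<Rightarrow> bool" where
  multilocal: "unitary A \<Longrightarrow> unitary B \<Longrightarrow> multilocal_perm (A \<otimes>\<^sub>o B)"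
| permutation: "unitary W \<Longrightarrow> multilocal_perm (swap_factors W)"
| product: "multilocal_perm V \<Longrightarrow> multilocal_perm V' \<Longrightarrow> multilocal_perm (V \<circ> V')"

text \<open>
  Unitaries defined on a subspace H are represented by functions that are undefined outside H
  (\<^const>\<open>extensional\<close>), so that equality of functions is equality of unitaries.
\<close>

definition tps_equiv ::
    "'k::chilbert_space set
      \<Rightarrow> (('k \<Rightarrow> 's::chilbert_space ^ 'n::finite) \<times> ('k \<Rightarrow> 's ^ 'n)) set"
  where "tps_equiv H = {(T1, T2).
    T1 \<in> extensional H \<and> unitary_on H T1 \<and> T2 \<in> extensional H \<and> unitary_on H T2 \<and>
    multilocal_perm (T2 \<circ> inv_into H T1)}"

definition TPS ::
    "'k::chilbert_space set \<Rightarrow> ('k \<Rightarrow> 's::chilbert_space ^ 'n::finite)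
      \<Rightarrow> ('k \<Rightarrow> 's ^ 'n) set"
  where "TPS H T = tps_equiv H `` {T}"

text \<open>
  The finite abelian group is a type 'g of classes finite and ab_group_add, written additively.
  The kinematical space, the tensor product of the two frame spaces and the system space in this
  order, is \<^typ>\<open>'s ^ 'g ^ 'g\<close>: the outer index belongs to the first frame.
\<close>

definition unitary_rep :: "('g::ab_group_add \<Rightarrow> 's::chilbert_space \<Rightarrow> 's) \<Rightarrow> bool"
  where "unitary_rep U \<longleftrightarrow>
    (\<forall>g. unitary (U g)) \<and> U 0 = id \<and> (\<forall>g h. U (g + h) = U g \<circ> U h)"

definition regular_rep :: "'g::{finite, ab_group_add} \<Rightarrow> (complex, 'g) vec \<Rightarrow> (complex, 'g) vec"
  where "regular_rep g a = (\<Sum>h\<in>UNIV. (a $ h) *\<^sub>C ket (g + h))"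

definition kin_rep ::
    "('g::{finite, ab_group_add} \<Rightarrow> 's::chilbert_space \<Rightarrow> 's)
      \<Rightarrow> 'g \<Rightarrow> (('s, 'g) vec, 'g) vec \<Rightarrow> (('s, 'g) vec, 'g) vec"
  where "kin_rep U g = regular_rep g \<otimes>\<^sub>o regular_rep g \<otimes>\<^sub>o U g"

definition phys_proj ::
    "('g::{finite, ab_group_add} \<Rightarrow> 's::chilbert_space \<Rightarrow> 's)
      \<Rightarrow> (('s, 'g) vec, 'g) vec \<Rightarrow> (('s, 'g) vec, 'g) vec"
  where "phys_proj U v = (1 / of_nat CARD('g)) *\<^sub>C (\<Sum>g\<in>UNIV. kin_rep U g v)"

definition phys_space ::
    "('g::{finite, ab_group_add} \<Rightarrow> 's::chilbert_space \<Rightarrow> 's) \<Rightarrow> (('s, 'g) vec, 'g) vec set"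
  where "phys_space U = range (phys_proj U)"

definition reduction1 ::
    "('g::{finite, ab_group_add} \<Rightarrow> 's::chilbert_space \<Rightarrow> 's)
      \<Rightarrow> 'g \<Rightarrow> (('s, 'g) vec, 'g) vec \<Rightarrow> ('s, 'g) vec"
  where "reduction1 U g = (\<lambda>v\<in>phys_space U.
    complex_of_real (sqrt (real CARD('g))) *\<^sub>C partial_bra (ket g) (phys_proj U v))"

definition reduction2 ::
    "('g::{finite, ab_group_add} \<Rightarrow> 's::chilbert_space \<Rightarrow> 's)
      \<Rightarrow> 'g \<Rightarrow> (('s, 'g) vec, 'g) vec \<Rightarrow> ('s, 'g) vec"
  where "reduction2 U g = (\<lambda>v\<in>phys_space U.
    complex_of_real (sqrt (real CARD('g))) *\<^sub>C
      (id \<otimes>\<^sub>o partial_bra (ket g)) (phys_proj U v))"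

text \<open>
  If every \<open>U g\<close> is a scalar \<open>c g\<close>, then the change of perspective
  \<open>reduction2 U g2 \<circ> inv_into (phys_space U) (reduction1 U g1)\<close> is \<open>A \<otimes>\<^sub>o id\<close> with A the unitary
  sending \<open>ket (g2 - g)\<close> to \<open>c g *\<^sub>C ket (g + g1)\<close>, so the two tensor product structures coincide;
  inequivalence therefore requires a representation that is not scalar.
\<close>

end

theory Submission
  imports Defs
begin

text \<open>
  A product of multilocal unitaries and permutations maps product vectors to product vectors, acting
  either as \<open>a \<otimes>\<^sub>v x \<mapsto> A a \<otimes>\<^sub>v B x\<close> or as \<open>a \<otimes>\<^sub>v x \<mapsto> C x \<otimes>\<^sub>v D a\<close>. The change of perspective sends
  \<open>ket h \<otimes>\<^sub>v x\<close> to \<open>ket (g1 + g2 - h) \<otimes>\<^sub>v U (g1 - h) x\<close>. The first form would make every \<open>U (g1 - h)\<close>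
  a multiple of the same B, hence a scalar, since \<open>U 0\<close> is the identity. In the second form the first
  factor depends, up to a scalar, only on x, whereas \<open>ket (g1 + g2 - h)\<close> varies with h.
\<close>

section \<open>Linear and unitary maps\<close>

lemma tensor_nth [simp]: "(a \<otimes>\<^sub>v x) $ i = (a $ i) *\<^sub>C x"
  by (simp add: tensor_def)

lemma scaleC_eq_0_iff [simp]: "c *\<^sub>C x = 0 \<longleftrightarrow> c = 0 \<or> x = 0" for x :: "'a::chilbert_space"
proof -
  have "x = 0" if "c *\<^sub>C x = 0" "c \<noteq> 0"
    using scaleC_scaleC[of "1 / c" c x] that by simp
  then show ?thesis by auto
qed

lemma clinear_onD:
  assumes "clinear_on UNIV A"
  shows "A (x + y) = A x + A y" "A (c *\<^sub>C x) = c *\<^sub>C A x" "A 0 = 0"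
proof -
  show "A (x + y) = A x + A y" and *: "A (c *\<^sub>C x) = c *\<^sub>C A x" for x c
    using assms by (auto simp: clinear_on_def)
  show "A 0 = 0" using *[of 0 0] by simp
qed

lemma clinear_on_sum:
  assumes "clinear_on UNIV A"
  shows "A (\<Sum>i\<in>I. f i) = (\<Sum>i\<in>I. A (f i))"
  by (induction I rule: infinite_finite_induct) (auto simp: clinear_onD[OF assms])

lemma ket_expansion: "a = (\<Sum>i\<in>UNIV. (a $ i) *\<^sub>C ket i)"
  by (simp add: vec_eq_iff ket_nth scaleC_complex_def if_distrib cong: if_cong)

lemma cinner_self_eq_0_iff [simp]: "cinner x x = 0 \<longleftrightarrow> x = 0" for x :: "'a::chilbert_space"
  using cinner_self_Re[of x] by auto

lemma cinner_minus_right: "cinner x (y - z) = cinner x y - cinner x z" for x :: "'a::chilbert_space"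
  using cinner_add_right[of x "y - z" z] by (simp add: algebra_simps)

lemma cinner_minus_left: "cinner (x - y) z = cinner x z - cinner y z" for x :: "'a::chilbert_space"
  using cinner_add_left[of "x - y" y z] by (simp add: algebra_simps)

lemma unitary_on_inj:
  assumes "unitary_on H T"
  shows "inj_on T H"
proof (rule inj_onI)
  fix x y assume xy: "x \<in> H" "y \<in> H" "T x = T y"
  \<comment> \<open>Expanding the square of \<open>x - y\<close> leaves only inner products of
    members of \<open>H\<close>, so \<open>H\<close> need not be closed under subtraction.\<close>
  have "cinner u v = cinner (T u) (T v)" if "u \<in> H" "v \<in> H" for u v
    using assms that by (auto simp: unitary_on_def)
  then have "cinner (x - y) (x - y) = 0"
    using xy by (simp add: cinner_minus_left cinner_minus_right)
  then show "x = y" by simp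
qed

section \<open>Multilocal unitaries and permutations on product vectors\<close>

lemma swap_factors_tensor:
  assumes "unitary W"
  shows "swap_factors W (a \<otimes>\<^sub>v x) = inv W x \<otimes>\<^sub>v W a"
proof -
  have lin: "clinear_on UNIV W" and surj: "surj W"
    using assms by (auto simp: unitary_on_def)
  have inv: "inv W (c *\<^sub>C y) = c *\<^sub>C inv W y" for c y
    by (rule inv_f_eq) (auto simp: unitary_on_inj[OF assms] clinear_onD[OF lin] surj_f_inv_f[OF surj])
  have W: "W a = (\<Sum>i\<in>UNIV. (a $ i) *\<^sub>C W (ket i))"
    by (subst ket_expansion[of a]) (simp add: clinear_on_sum[OF lin] clinear_onD[OF lin])
  show ?thesis
    by (simp add: vec_eq_iff swap_factors_def inv W scaleC_sum_right scaleC_scaleC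
        scaleC_complex_def mult.commute)
qed

text \<open>Only the shape of the image is recorded, with arbitrary functions in place of unitaries.
  This makes the claim stable under composition: the functions compose, and two exchanges
  cancel.\<close>

lemma multilocal_perm_tensor:
  assumes "multilocal_perm V"
  shows "(\<exists>A B. \<forall>a x. V (a \<otimes>\<^sub>v x) = A a \<otimes>\<^sub>v B x) \<or> (\<exists>C D. \<forall>a x. V (a \<otimes>\<^sub>v x) = C x \<otimes>\<^sub>v D a)"
  using assms
proof induction
  case (multilocal A B)
  then have "(A \<otimes>\<^sub>o B) (a \<otimes>\<^sub>v x) = A a \<otimes>\<^sub>v B x" for a x
    by (intro tensor_op_tensor) (auto simp: unitary_on_def)
  then show ?case by blast
next
  case (permutation W)
  then show ?case using swap_factors_tensor by blast
next
  case (product V V')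
  let ?P = "\<lambda>V A B. \<forall>a x. V (a \<otimes>\<^sub>v x) = A a \<otimes>\<^sub>v B x"
  let ?Q = "\<lambda>V C D. \<forall>a x. V (a \<otimes>\<^sub>v x) = C x \<otimes>\<^sub>v D a"
  from product.IH show ?case
  proof (elim disjE exE)
    fix A B A' B' assume "?P V A B" "?P V' A' B'"
    then have "?P (V \<circ> V') (A \<circ> A') (B \<circ> B')" by simp
    then show ?thesis by blast
  next
    fix A B C' D' assume "?P V A B" "?Q V' C' D'"
    then have "?Q (V \<circ> V') (A \<circ> C') (B \<circ> D')" by simp
    then show ?thesis by blast
  next
    fix C D A' B' assume "?Q V C D" "?P V' A' B'"
    then have "?Q (V \<circ> V') (C \<circ> B') (D \<circ> A')" by simp
    then show ?thesis by blast
  next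
    fix C D C' D' assume "?Q V C D" "?Q V' C' D'"
    then have "?P (V \<circ> V') (C \<circ> D') (D \<circ> C')" by simp
    then show ?thesis by blast
  qed
qed

lemma not_multilocal_perm_controlled:
  fixes V :: "'s::chilbert_space ^ 'n::finite \<Rightarrow> 's ^ 'n" and F :: "'n \<Rightarrow> 's \<Rightarrow> 's"
  assumes V: "\<And>h x. V (ket h \<otimes>\<^sub>v x) = ket (\<sigma> h) \<otimes>\<^sub>v F h x"
    and \<sigma>: "\<sigma> h1 \<noteq> \<sigma> h2"
    and nonzero: "\<And>h x. x \<noteq> 0 \<Longrightarrow> F h x \<noteq> 0"
    and F0: "\<And>x. F h0 x = x"
    and not_scalar: "\<not> (\<exists>c. \<forall>x. F h x = c *\<^sub>C x)"
  shows "\<not> multilocal_perm V"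
proof
  assume "multilocal_perm V"
  then consider A B where "\<And>a x. V (a \<otimes>\<^sub>v x) = A a \<otimes>\<^sub>v B x"
    | C D where "\<And>a x. V (a \<otimes>\<^sub>v x) = C x \<otimes>\<^sub>v D a"
    using multilocal_perm_tensor by blast
  \<comment> \<open>On the zero space every \<open>F h\<close> would be multiplication by 1.\<close>
  moreover obtain x0 :: 's where x0: "x0 \<noteq> 0"
    using not_scalar F0 nonzero by (metis scaleC_one)
  ultimately show False
  proof cases
    case 1
    \<comment> \<open>The entry of \<open>ket (\<sigma> k)\<close> at \<sigma> k is 1, so this
      component isolates \<open>F k x\<close>.\<close>
    have F: "F k x = (A (ket k) $ \<sigma> k) *\<^sub>C B x" for k x
      using arg_cong[OF V[of k x], of "\<lambda>v. v $ \<sigma> k"] by (simp add: 1 ket_nth)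
    let ?a = "A (ket h0) $ \<sigma> h0"
    \<comment> \<open>Since \<open>F h0\<close> is the identity, \<open>?a\<close> times
      \<open>B x0\<close> is \<open>x0\<close>, which is nonzero.\<close>
    have "?a \<noteq> 0"
      using F[of h0 x0] F0 x0 by auto
    then have "B x = (1 / ?a) *\<^sub>C x" for x
      using F[of h0 x] F0[of x] scaleC_scaleC[of "1 / ?a" ?a "B x"] by simp
    then have "\<forall>x. F h x = (A (ket h) $ \<sigma> h * (1 / ?a)) *\<^sub>C x"
      by (simp add: F scaleC_scaleC)
    then show False using not_scalar by blast
  next
    case 2
    have F: "(C x0 $ k) *\<^sub>C D (ket h) = (if \<sigma> h = k then F h x0 else 0)" for k h
      using arg_cong[OF V[of h x0], of "\<lambda>v. v $ k"] by (simp add: 2 ket_nth)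
    show False
      \<comment> \<open>The first instance makes the entry of \<open>C x0\<close> at
        \<open>\<sigma> h1\<close> nonzero, the second then forces \<open>D (ket h2)\<close> to
        vanish, and the third contradicts this.\<close>
      using F[of "\<sigma> h1" h1] F[of "\<sigma> h1" h2] F[of "\<sigma> h2" h2] nonzero[OF x0] \<sigma>
      by (metis scaleC_eq_0_iff)
  qed
qed

section \<open>The physical space and the reduction maps\<close>

lemma unitary_repD:
  assumes "unitary_rep U"
  shows "clinear_on UNIV (U g)" "cinner (U g x) (U g y) = cinner x y"
    "U 0 x = x" "U g (U h x) = U (g + h) x"
  using assms by (auto simp: unitary_rep_def unitary_on_def)

lemma regular_rep_ket: "regular_rep g (ket i) = ket (g + i)"
proof -
  have "regular_rep g (ket i) = (\<Sum>h\<in>UNIV. if h = i then ket (g + h) else 0)"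
    unfolding regular_rep_def by (rule sum.cong) (auto simp: ket_nth)
  then show ?thesis by simp
qed

lemma sum_ket_shift:
  fixes f :: "'g::{finite, ab_group_add} \<Rightarrow> 's::chilbert_space"
  shows "(\<Sum>k\<in>UNIV. (ket (g + k) $ i) *\<^sub>C f k) = f (i - g)"
proof -
  have "(\<Sum>k\<in>UNIV. (ket (g + k) $ i) *\<^sub>C f k) = (\<Sum>k\<in>UNIV. if k = i - g then f k else 0)"
    by (rule sum.cong) (auto simp: ket_nth)
  then show ?thesis by simp
qed

text \<open>The group translates both frame indices while \<open>U g\<close> acts on the entries.
  This reduces the later arguments to index computations.\<close>

lemma kin_rep_nth: "kin_rep U g v $ i $ j = U g (v $ (i - g) $ (j - g))"
  by (simp add: kin_rep_def tensor_op_def regular_rep_ket sum_ket_shift)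

lemma partial_bra_ket: "partial_bra (ket g) v = v $ g"
  by (simp add: partial_bra_def cinner_ket if_distrib[of "\<lambda>c. c *\<^sub>C _"] cong: if_cong)

lemma id_tensor_op_nth: "(id \<otimes>\<^sub>o B) v $ i = B (v $ i)"
  by (simp add: tensor_op_def ket_nth if_distrib[of "\<lambda>c. c *\<^sub>C _"] cong: if_cong)

lemma phys_proj_nth:
  "phys_proj U v $ i $ j
    = (1 / of_nat CARD('g)) *\<^sub>C (\<Sum>g\<in>UNIV. U g (v $ (i - g) $ (j - g)))"
  for U :: "'g::{finite, ab_group_add} \<Rightarrow> 's::chilbert_space \<Rightarrow> 's"
  by (simp add: phys_proj_def kin_rep_nth)

text \<open>The inverse of \<open>reduction1 U g\<close>: the slice at first index \<open>g\<close>
  is \<open>u\<close> up to normalisation, and invariance under translation by \<open>i - g\<close>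
  dictates the slice at \<open>i\<close>. For a unitary representation this is the projection of
  \<open>ket g \<otimes>\<^sub>v u\<close>, rescaled by the square root of the group order.\<close>

definition lift1 ::
    "('g::{finite, ab_group_add} \<Rightarrow> 's::chilbert_space \<Rightarrow> 's) \<Rightarrow> 'g \<Rightarrow> ('s, 'g) vec \<Rightarrow> (('s, 'g) vec, 'g) vec"
  where "lift1 U g u = (\<chi> i j. complex_of_real (1 / sqrt (real CARD('g))) *\<^sub>C
    U (i - g) (u $ (j - i + g)))"

context
  fixes U :: "'g::{finite, ab_group_add} \<Rightarrow> 's::chilbert_space \<Rightarrow> 's"
  assumes rep: "unitary_rep U"
begin

lemma phys_proj_invariant:
  "U g (phys_proj U v $ i $ j) = phys_proj U v $ (i + g) $ (j + g)"
proof -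
  have "(\<Sum>h\<in>UNIV. U (g + h) (v $ (i - h) $ (j - h)))
      = (\<Sum>h\<in>UNIV. U h (v $ (i + g - h) $ (j + g - h)))"
    by (rule sum.reindex_bij_witness[of _ "\<lambda>h. h - g" "\<lambda>h. g + h"]) (auto simp: algebra_simps)
  then show ?thesis
    by (simp add: phys_proj_nth clinear_on_sum[OF unitary_repD(1)[OF rep]]
        clinear_onD[OF unitary_repD(1)[OF rep]] unitary_repD[OF rep])
qed

lemma phys_proj_fixed:
  assumes "\<And>g i j. U g (v $ i $ j) = v $ (i + g) $ (j + g)"
  shows "phys_proj U v = v"
proof -
  have "(\<Sum>g\<in>(UNIV::'g set). w) = of_nat CARD('g) *\<^sub>C w" for w :: 's
    using scaleC_sum_left[of "\<lambda>_. 1" "UNIV :: 'g set" w] by simp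
  then show ?thesis
    by (simp add: vec_eq_iff phys_proj_nth assms scaleC_scaleC)
qed

text \<open>Averaging over the group produces invariant vectors, and on an invariant vector all
  summands of the average agree.\<close>

lemma phys_space_iff: "v \<in> phys_space U \<longleftrightarrow> (\<forall>g i j. U g (v $ i $ j) = v $ (i + g) $ (j + g))"
proof
  show "v \<in> phys_space U \<Longrightarrow> \<forall>g i j. U g (v $ i $ j) = v $ (i + g) $ (j + g)"
    by (auto simp: phys_space_def phys_proj_invariant)
  show "\<forall>g i j. U g (v $ i $ j) = v $ (i + g) $ (j + g) \<Longrightarrow> v \<in> phys_space U"
    unfolding phys_space_def using phys_proj_fixed by (metis rangeI)
qed

lemma phys_proj_phys_space: "v \<in> phys_space U \<Longrightarrow> phys_proj U v = v"
  by (rule phys_proj_fixed) (simp add: phys_space_iff)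

lemma phys_space_add: "v \<in> phys_space U \<Longrightarrow> w \<in> phys_space U \<Longrightarrow> v + w \<in> phys_space U"
  by (simp add: phys_space_iff clinear_onD[OF unitary_repD(1)[OF rep]])

lemma phys_space_scaleC: "v \<in> phys_space U \<Longrightarrow> c *\<^sub>C v \<in> phys_space U"
  by (simp add: phys_space_iff clinear_onD[OF unitary_repD(1)[OF rep]])

lemma reduction1_phys_space:
  "v \<in> phys_space U \<Longrightarrow> reduction1 U g v = complex_of_real (sqrt (real CARD('g))) *\<^sub>C (v $ g)"
  by (simp add: reduction1_def phys_proj_phys_space partial_bra_ket)

lemma reduction2_phys_space_nth:
  "v \<in> phys_space U \<Longrightarrow>
    reduction2 U g v $ i = complex_of_real (sqrt (real CARD('g))) *\<^sub>C (v $ i $ g)"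
  by (simp add: reduction2_def phys_proj_phys_space id_tensor_op_nth partial_bra_ket)

lemma lift1_nth:
  "lift1 U g u $ i $ j = complex_of_real (1 / sqrt (real CARD('g))) *\<^sub>C U (i - g) (u $ (j - i + g))"
  by (simp add: lift1_def)

lemma lift1_in_phys_space: "lift1 U g u \<in> phys_space U"
  by (simp add: phys_space_iff lift1_nth clinear_onD[OF unitary_repD(1)[OF rep]]
      unitary_repD[OF rep] algebra_simps)

lemma reduction1_lift1: "reduction1 U g (lift1 U g u) = u"
  by (simp add: vec_eq_iff reduction1_phys_space[OF lift1_in_phys_space] lift1_nth
      unitary_repD[OF rep] scaleC_scaleC flip: of_real_mult)

lemma reduction2_lift1_nth: "reduction2 U h (lift1 U g u) $ i = U (i - g) (u $ (h - i + g))"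
  by (simp add: reduction2_phys_space_nth[OF lift1_in_phys_space] lift1_nth
      scaleC_scaleC flip: of_real_mult)

text \<open>Translation by \<open>i - g\<close> carries slice \<open>g\<close> to slice
  \<open>i\<close>, applying a unitary to the entries and permuting the second index, so all slices
  contribute equally.\<close>

lemma cinner_phys_space:
  assumes "v \<in> phys_space U" "w \<in> phys_space U"
  shows "cinner v w = of_nat CARD('g) * cinner (v $ g) (w $ g)"
proof -
  have "cinner (v $ i) (w $ i) = cinner (v $ g) (w $ g)" for i
  proof -
    have "cinner (v $ g $ j) (w $ g $ j) = cinner (v $ i $ (j + (i - g))) (w $ i $ (j + (i - g)))" for j
      using assms unitary_repD(2)[OF rep, of "i - g" "v $ g $ j" "w $ g $ j"]
      by (simp add: phys_space_iff)
    then show ?thesis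
      unfolding cinner_vec_def
      by (intro sum.reindex_bij_witness[of _ "\<lambda>j. j + (i - g)" "\<lambda>j. j - (i - g)"]) auto
  qed
  then have "cinner v w = (\<Sum>i\<in>(UNIV::'g set). cinner (v $ g) (w $ g))"
    unfolding cinner_vec_def[of v w] by (intro sum.cong refl)
  then show ?thesis by simp
qed

lemma unitary_on_reduction1: "unitary_on (phys_space U) (reduction1 U g)"
proof -
  have "complex_of_real (sqrt (real CARD('g))) * complex_of_real (sqrt (real CARD('g)))
      = of_nat CARD('g)"
    by (simp flip: of_real_mult)
  then have "cinner (reduction1 U g v) (reduction1 U g w) = cinner v w"
    if "v \<in> phys_space U" "w \<in> phys_space U" for v w
    using that by (simp add: reduction1_phys_space cinner_phys_space[of v w g] cinner_scaleC_left
        cinner_scaleC_right flip: mult.assoc)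
  moreover have "clinear_on (phys_space U) (reduction1 U g)"
    by (simp add: clinear_on_def reduction1_phys_space phys_space_add phys_space_scaleC
        scaleC_add_right scaleC_scaleC mult.commute)
  moreover have "reduction1 U g ` phys_space U = UNIV"
    using lift1_in_phys_space reduction1_lift1 by (metis UNIV_eq_I image_eqI)
  ultimately show ?thesis by (simp add: unitary_on_def)
qed

text \<open>The inverse of \<open>reduction2\<close> is evaluated by exhibiting a preimage, namely
  \<open>lift1 U g1\<close> of the claimed result. Injectivity is a hypothesis because the theorem
  extracts it from the assumed equality of classes.\<close>

lemma change_of_perspective:
  assumes "inj_on (reduction2 U g2) (phys_space U)"
  shows "(reduction1 U g1 \<circ> inv_into (phys_space U) (reduction2 U g2)) (ket h \<otimes>\<^sub>v x)
    = ket (g1 + g2 - h) \<otimes>\<^sub>v U (g1 - h) x"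
proof -
  let ?u = "ket (g1 + g2 - h) \<otimes>\<^sub>v U (g1 - h) x"
  \<comment> \<open>Component \<open>i\<close> of the reduced vector reads \<open>?u\<close> at
    \<open>g2 - i + g1\<close>. It survives only for \<open>i = h\<close>, where
    \<open>U (h - g1)\<close> cancels \<open>U (g1 - h)\<close>.\<close>
  have *: "g1 + g2 - h = g2 - i + g1 \<longleftrightarrow> h = i" for i
    by (auto simp: algebra_simps)
  have "reduction2 U g2 (lift1 U g1 ?u) = ket h \<otimes>\<^sub>v x"
    by (auto simp: vec_eq_iff reduction2_lift1_nth ket_nth * unitary_repD[OF rep]
        clinear_onD[OF unitary_repD(1)[OF rep]])
  then have "inv_into (phys_space U) (reduction2 U g2) (ket h \<otimes>\<^sub>v x) = lift1 U g1 ?u"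
    using inv_into_f_f[OF assms lift1_in_phys_space] by metis
  then show ?thesis by (simp add: reduction1_lift1)
qed

end

section \<open>Inequivalence of the two structures\<close>

lemma multilocal_perm_id: "multilocal_perm id"
proof -
  have "id \<otimes>\<^sub>o id = (id :: 's::chilbert_space ^ 'n::finite \<Rightarrow> 's ^ 'n)"
    by (simp add: fun_eq_iff vec_eq_iff id_tensor_op_nth)
  moreover have "unitary id"
    by (simp add: unitary_on_def clinear_on_def)
  ultimately show ?thesis using multilocal_perm.multilocal by metis
qed

theorem lemma1:
  fixes U :: "'g::{finite, ab_group_add} \<Rightarrow> 's::chilbert_space \<Rightarrow> 's"
    and g1 g2 :: 'g
  assumes nontrivial_group: "(UNIV :: 'g set) \<noteq> {0}"
    and rep: "unitary_rep U"
    and not_scalar: "\<exists>g. \<not> (\<exists>c. \<forall>x. U g x = c *\<^sub>C x)"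
  shows "TPS (phys_space U) (reduction1 U g1) \<noteq> TPS (phys_space U) (reduction2 U g2)"
proof
  let ?H = "phys_space U" and ?R1 = "reduction1 U g1" and ?R2 = "reduction2 U g2"
  let ?V = "?R1 \<circ> inv_into ?H ?R2"
  assume eq: "TPS ?H ?R1 = TPS ?H ?R2"
  have uni: "unitary_on ?H ?R1" by (rule unitary_on_reduction1[OF rep])
  then have "?R1 ` ?H = UNIV" by (simp add: unitary_on_def)
  then have "?R1 \<circ> inv_into ?H ?R1 = id"
    by (simp add: fun_eq_iff f_inv_into_f)
  moreover have "?R1 \<in> extensional ?H" by (simp add: reduction1_def)
  ultimately have "?R1 \<in> TPS ?H ?R1"
    using uni by (simp add: TPS_def tps_equiv_def multilocal_perm_id)
  \<comment> \<open>By reflexivity \<open>?R1\<close> lies in its own class, hence in that of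
    \<open>?R2\<close>. Unfolding this membership yields both the unitarity of \<open>?R2\<close>
    and the change of perspective from the second frame to the first.\<close>
  then have R2: "unitary_on ?H ?R2" and V: "multilocal_perm ?V"
    unfolding eq by (auto simp: TPS_def tps_equiv_def)
  obtain g where g: "\<not> (\<exists>c. \<forall>x. U g x = c *\<^sub>C x)" using not_scalar by blast
  obtain k :: 'g where "k \<noteq> 0" using nontrivial_group by auto
  then have "g1 + g2 - 0 \<noteq> g1 + g2 - k" by simp
  moreover have "U h x \<noteq> 0" if "x \<noteq> 0" for h x
    using unitary_repD(2)[OF rep, of h x x] that by (metis cinner_self_eq_0_iff)
  \<comment> \<open>The control value \<open>g1\<close> selects \<open>U 0\<close>, the identity,
    and \<open>g1 - g\<close> selects the non-scalar \<open>U g\<close>; the values 0 and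
    \<open>k\<close> witness that the ket label varies.\<close>
  moreover have "U (g1 - g1) x = x" for x
    by (simp add: unitary_repD[OF rep])
  moreover have "\<not> (\<exists>c. \<forall>x. U (g1 - (g1 - g)) x = c *\<^sub>C x)" using g by simp
  moreover have "?V (ket h \<otimes>\<^sub>v x) = ket (g1 + g2 - h) \<otimes>\<^sub>v U (g1 - h) x" for h x
    by (rule change_of_perspective[OF rep unitary_on_inj[OF R2]])
  ultimately have "\<not> multilocal_perm ?V"
    by (intro not_multilocal_perm_controlled[where \<sigma> = "\<lambda>h. g1 + g2 - h" and F = "\<lambda>h. U (g1 - h)"
        and ?h1.0 = 0 and ?h2.0 = k and ?h0.0 = g1 and h = "g1 - g"]) auto
  then show False using V by contradiction
qed

end
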